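(* Let $\mathcal{D}$ be a non-empty set of bounded random variables and let $\underline{P}:\mathcal{D}\to\mathbb{R}$ be bi-coherent. If either $-X\in\mathcal{D}$ for all $X\in\mathcal{D}$, or $X+Y\in\mathcal{D}$ for all $X,Y\in\mathcal{D}$, then $\underline{P}$ is dF-coherent on $\mathcal{D}$.
   Context: Bounded random variables are bounded real-valued functions on a common non-empty set of atoms; $\sup$ is the supremum over all atoms. A map $\underline{P}:\mathcal{D}\to\mathbb{R}$ is a bi-coherent lower prevision on $\mathcal{D}$ iff for all integers $n\ge 0$, all $X_1,\dots,X_n,Y_1,Y_2\in\mathcal{D}$ and all real $s_1,\dots,s_n,r_1,r_2\ge 0$, putting $G=\sum_{i=1}^n s_i(X_i-\underline{P}(X_i))-r_1(Y_1-\underline{P}(Y_1))-r_2(Y_2-\underline{P}(Y_2))$, one has $\sup G\ge 0$. A map $P:\mathcal{D}\to\mathbb{R}$ is dF-coherent (a dF-coherent precise prevision) on $\mathcal{D}$ iff for all integers $n,m\ge 0$, all $X_1,\dots,X_n,Y_1,\dots,Y_m\in\mathcal{D}$ and all real $s_1,\dots,s_n\ge 0$, $r_1,\dots,r_m\ge 0$, putting $G=\sum_{i=1}^n s_i(X_i-P(X_i))-\sum_{j=1}^m r_j(Y_j-P(Y_j))$, one has $\sup G\ge 0$. *)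

theory Defs
  imports "HOL-Analysis.Analysis"
begin

text \<open>
  The atoms are the elements of an arbitrary type \<open>'w\<close>, which is non-empty as every type is, and
  a bounded random variable is a function \<open>X :: 'w \<Rightarrow> real\<close> with \<open>bounded (range X)\<close>. A prevision
  on \<open>D\<close> is represented by a total function of which only the values on \<open>D\<close> matter.
  The supremum on the reals is the true supremum only for functions that are bounded
  above; the definitions below are meant for sets \<open>D\<close> of bounded random variables, where every
  gain is bounded.
\<close>

definition bi_coherent :: "('w \<Rightarrow> real) set \<Rightarrow> (('w \<Rightarrow> real) \<Rightarrow> real) \<Rightarrow> bool" where
  "bi_coherent D P \<longleftrightarrow>
    (\<forall>(n::nat) (X :: nat \<Rightarrow> 'w \<Rightarrow> real) (s :: nat \<Rightarrow> real) Y1 Y2 (r1::real) (r2::real).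
      (\<forall>i\<in>{1..n}. X i \<in> D \<and> s i \<ge> 0) \<and> Y1 \<in> D \<and> Y2 \<in> D \<and> r1 \<ge> 0 \<and> r2 \<ge> 0 \<longrightarrow>
      (SUP w. (\<Sum>i=1..n. s i * (X i w - P (X i))) - r1 * (Y1 w - P Y1) - r2 * (Y2 w - P Y2)) \<ge> 0)"

definition dF_coherent :: "('w \<Rightarrow> real) set \<Rightarrow> (('w \<Rightarrow> real) \<Rightarrow> real) \<Rightarrow> bool" where
  "dF_coherent D P \<longleftrightarrow>
    (\<forall>(n::nat) (m::nat) (X :: nat \<Rightarrow> 'w \<Rightarrow> real) (Y :: nat \<Rightarrow> 'w \<Rightarrow> real)
        (s :: nat \<Rightarrow> real) (r :: nat \<Rightarrow> real).
      (\<forall>i\<in>{1..n}. X i \<in> D \<and> s i \<ge> 0) \<and> (\<forall>j\<in>{1..m}. Y j \<in> D \<and> r j \<ge> 0) \<longrightarrow>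
      (SUP w. (\<Sum>i=1..n. s i * (X i w - P (X i))) - (\<Sum>j=1..m. r j * (Y j w - P (Y j)))) \<ge> 0)"

end

theory Submission
  imports Defs
begin

text \<open>
  A bi-coherent \<open>P\<close> tolerates arbitrarily many bets in favour of elements of \<open>D\<close>, but at most two
  against. So it suffices to turn an arbitrary family of bets against \<open>Y\<^sub>1, \<dots>, Y\<^sub>m\<close>, with
  stakes \<open>r\<^sub>1, \<dots>, r\<^sub>m \<ge> 0\<close>, into bets in favour plus at most one bet against, with the same gain
  at every atom.

  If \<open>D\<close> is closed under negation, bi-coherence applied to \<open>X\<close> and \<open>-X\<close> only, on either side,
  gives \<open>P (-X) = - P X\<close> (\<open>bi_coherent_minus\<close>). A bet against \<open>Y\<close> is then a bet in favour of
  \<open>-Y\<close>, and no bet against remains.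

  If \<open>D\<close> is closed under addition, setting bets on \<open>X\<close> and \<open>Y\<close> against an opposite bet on \<open>X + Y\<close>
  gives \<open>P (X + Y) = P X + P Y\<close> (\<open>bi_coherent_add\<close>). Hence bets against with natural stakes merge
  into at most one bet against an element of \<open>D\<close> (\<open>unit_gains_natural_combination\<close>). A real stake
  \<open>r\<close> is first rounded up to a natural number \<open>k\<close>; the excess \<open>k - r \<ge> 0\<close> becomes the stake of a
  bet in favour, of which there may be any number. The gain is thereby rewritten exactly.
\<close>

text \<open>
  Two families of bets in favour are kept apart here because both cases of the theorem add
  new bets in favour to those already present.
\<close>

lemma bi_coherent_two_families:
  fixes n m :: nat
  assumes "bi_coherent D P"
    and X: "\<And>i. i \<in> {1..n} \<Longrightarrow> X i \<in> D \<and> s i \<ge> 0"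
    and U: "\<And>j. j \<in> {1..m} \<Longrightarrow> U j \<in> D \<and> t j \<ge> 0"
    and Z: "Z \<in> D" "r \<ge> 0"
  shows "(SUP w. (\<Sum>i=1..n. s i * (X i w - P (X i))) + (\<Sum>j=1..m. t j * (U j w - P (U j)))
            - r * (Z w - P Z)) \<ge> 0"
proof -
  define V where "V i = (if i \<le> n then X i else U (i - n))" for i
  define q where "q i = (if i \<le> n then s i else t (i - n))" for i
  have V: "V i \<in> D \<and> q i \<ge> 0" if "i \<in> {1..n+m}" for i
  proof (cases "i \<le> n")
    case True
    then show ?thesis
      using that X[of i] by (simp add: V_def q_def)
  next
    case False
    then have "i - n \<in> {1..m}"
      using that by auto
    then show ?thesis
      using False U[of "i - n"] by (simp add: V_def q_def)
  qed
  have eq: "(\<Sum>i=1..n+m. q i * (V i w - P (V i))) =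
      (\<Sum>i=1..n. s i * (X i w - P (X i))) + (\<Sum>j=1..m. t j * (U j w - P (U j)))" for w
  proof -
    have "(\<Sum>i=1..n+m. q i * (V i w - P (V i))) = (\<Sum>i=1..n. q i * (V i w - P (V i))) +
        (\<Sum>i=n+1..n+m. q i * (V i w - P (V i)))"
      by (rule sum.ub_add_nat) simp
    also have "(\<Sum>i=n+1..n+m. q i * (V i w - P (V i))) =
        (\<Sum>j=1..m. q (j + n) * (V (j + n) w - P (V (j + n))))"
      using sum.shift_bounds_cl_nat_ivl[of "\<lambda>i. q i * (V i w - P (V i))" 1 n m]
      by (simp add: add.commute)
    finally show ?thesis
      by (simp add: V_def q_def)
  qed
  have "(SUP w. (\<Sum>i=1..n+m. q i * (V i w - P (V i))) - r * (Z w - P Z) - 0 * (Z w - P Z)) \<ge> 0"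
    using assms(1)[unfolded bi_coherent_def, rule_format, of "n + m" V q Z Z r 0] V Z by blast
  then show ?thesis
    by (simp only: eq) simp
qed

lemma bi_coherent_minus:
  assumes bi: "bi_coherent D P" and X: "X \<in> D" "(\<lambda>w. - X w) \<in> D"
  shows "P (\<lambda>w. - X w) = - P X"
proof (rule antisym)
  \<comment> \<open>The gain of betting on \<open>X\<close> and \<open>-X\<close>, on the same side, is a constant.\<close>
  have "(SUP w. (\<Sum>i=1..1::nat. 1 * (X w - P X)) + (\<Sum>j=1..1::nat. 1 * (- X w - P (\<lambda>w. - X w)))
            - 0 * (X w - P X)) \<ge> 0"
    using X by (intro bi_coherent_two_families[OF bi]) auto
  then show "P (\<lambda>w. - X w) \<le> - P X"
    by simp
next
  have "(SUP w. (\<Sum>i=1..0::nat. 1 * (X w - P X)) - 1 * (X w - P X)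
            - 1 * (- X w - P (\<lambda>w. - X w))) \<ge> 0"
    using bi[unfolded bi_coherent_def, rule_format,
        of 0 "\<lambda>_. X" "\<lambda>_. 1" X "\<lambda>w. - X w" 1 1] X by simp
  then show "- P X \<le> P (\<lambda>w. - X w)"
    by simp
qed

lemma bi_coherent_add:
  assumes bi: "bi_coherent D P" and "X \<in> D" "Y \<in> D" and XY: "(\<lambda>w. X w + Y w) \<in> D"
  shows "P (\<lambda>w. X w + Y w) = P X + P Y"
proof (rule antisym)
  have "(SUP w. (\<Sum>i=1..1::nat. 1 * (X w + Y w - P (\<lambda>w. X w + Y w))) - 1 * (X w - P X)
            - 1 * (Y w - P Y)) \<ge> 0"
    using bi[unfolded bi_coherent_def, rule_format,
        of 1 "\<lambda>_ w. X w + Y w" "\<lambda>_. 1" X Y 1 1] assms by simp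
  then show "P (\<lambda>w. X w + Y w) \<le> P X + P Y"
    by simp
next
  have "(SUP w. (\<Sum>i=1..1::nat. 1 * (X w - P X)) + (\<Sum>j=1..1::nat. 1 * (Y w - P Y))
            - 1 * (X w + Y w - P (\<lambda>w. X w + Y w))) \<ge> 0"
    using assms by (intro bi_coherent_two_families[OF bi]) auto
  then show "P X + P Y \<le> P (\<lambda>w. X w + Y w)"
    by simp
qed

text \<open>
  The empty bet is included because all the natural stakes to be merged may be zero, while \<open>D\<close>
  need not contain any constant.
\<close>

definition unit_gains :: "('w \<Rightarrow> real) set \<Rightarrow> (('w \<Rightarrow> real) \<Rightarrow> real) \<Rightarrow> ('w \<Rightarrow> real) set" where
  "unit_gains D P = insert (\<lambda>w. 0) ((\<lambda>Z w. Z w - P Z) ` D)"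

lemma unit_gains_add:
  assumes bi: "bi_coherent D P" and closed: "\<And>X Y. X \<in> D \<Longrightarrow> Y \<in> D \<Longrightarrow> (\<lambda>w. X w + Y w) \<in> D"
    and g: "g \<in> unit_gains D P" and h: "h \<in> unit_gains D P"
  shows "(\<lambda>w. g w + h w) \<in> unit_gains D P"
proof -
  have "(\<lambda>w. (X w - P X) + (Y w - P Y)) \<in> unit_gains D P" if "X \<in> D" "Y \<in> D" for X Y
  proof -
    have "(\<lambda>w. (X w - P X) + (Y w - P Y)) = (\<lambda>w. (X w + Y w) - P (\<lambda>w. X w + Y w))"
      using bi_coherent_add[OF bi that closed[OF that]] by auto
    then show ?thesis
      using closed[OF that] by (auto simp: unit_gains_def)
  qed
  then show ?thesis
    using g h by (auto simp: unit_gains_def)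
qed

text \<open>
  A natural stake is a repeated unit stake, so closure under addition suffices to merge the bets.
\<close>

lemma unit_gains_natural_combination:
  fixes m :: nat and k :: "nat \<Rightarrow> nat"
  assumes bi: "bi_coherent D P" and closed: "\<And>X Y. X \<in> D \<Longrightarrow> Y \<in> D \<Longrightarrow> (\<lambda>w. X w + Y w) \<in> D"
    and Y: "\<And>j. j \<in> {1..m} \<Longrightarrow> Y j \<in> D"
  shows "(\<lambda>w. \<Sum>j=1..m. real (k j) * (Y j w - P (Y j))) \<in> unit_gains D P"
  using Y
proof (induction m)
  case 0
  show ?case
    by (simp add: unit_gains_def)
next
  case (Suc m)
  have add: "(\<lambda>w. g w + h w) \<in> unit_gains D P"
    if "g \<in> unit_gains D P" "h \<in> unit_gains D P" for g h
    using bi closed that by (rule unit_gains_add)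
  have multiple: "(\<lambda>w. real l * (Z w - P Z)) \<in> unit_gains D P" if "Z \<in> D" for l Z
  proof (induction l)
    case 0
    show ?case
      by (simp add: unit_gains_def)
  next
    case (Suc l)
    have "(\<lambda>w. Z w - P Z) \<in> unit_gains D P"
      using that by (simp add: unit_gains_def)
    from add[OF this Suc] show ?case
      by (simp add: distrib_right)
  qed
  have "(\<lambda>w. \<Sum>j=1..m. real (k j) * (Y j w - P (Y j))) \<in> unit_gains D P"
    using Suc.prems by (intro Suc.IH) auto
  moreover have "Y (Suc m) \<in> D"
    using Suc.prems by simp
  ultimately show ?case
    using add[OF _ multiple[of "Y (Suc m)" "k (Suc m)"]] by simp
qed

theorem corollary1:
  fixes D :: "('w \<Rightarrow> real) set" and P :: "('w \<Rightarrow> real) \<Rightarrow> real"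
  assumes "D \<noteq> {}"
    and "\<And>X. X \<in> D \<Longrightarrow> bounded (range X)"
    and "bi_coherent D P"
    and "(\<forall>X\<in>D. (\<lambda>w. - X w) \<in> D) \<or> (\<forall>X\<in>D. \<forall>Y\<in>D. (\<lambda>w. X w + Y w) \<in> D)"
  shows "dF_coherent D P"
proof -
  obtain Z0 where Z0: "Z0 \<in> D"
    using assms(1) by blast
  have "(SUP w. (\<Sum>i=1..n. s i * (X i w - P (X i))) - (\<Sum>j=1..m. r j * (Y j w - P (Y j)))) \<ge> 0"
    if X: "\<forall>i\<in>{1..n}. X i \<in> D \<and> s i \<ge> 0" and Y: "\<forall>j\<in>{1..m}. Y j \<in> D \<and> r j \<ge> 0"
    for n m :: nat and X Y s r
    using assms(4)
  proof
    assume neg: "\<forall>X\<in>D. (\<lambda>w. - X w) \<in> D"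
    have "r j * (- Y j w - P (\<lambda>w. - Y j w)) = - (r j * (Y j w - P (Y j)))" if "j \<in> {1..m}" for j w
      using bi_coherent_minus[OF assms(3), of "Y j"] that neg Y by (simp add: algebra_simps)
    then have eq: "(\<Sum>j=1..m. r j * (- Y j w - P (\<lambda>w. - Y j w))) =
        - (\<Sum>j=1..m. r j * (Y j w - P (Y j)))" for w
      by (simp add: sum_negf)
    have "(SUP w. (\<Sum>i=1..n. s i * (X i w - P (X i)))
            + (\<Sum>j=1..m. r j * (- Y j w - P (\<lambda>w. - Y j w))) - 0 * (Z0 w - P Z0)) \<ge> 0"
      using X Y Z0 neg by (intro bi_coherent_two_families[OF assms(3)]) auto
    then show ?thesis
      by (simp only: eq) simp
  next
    assume closed: "\<forall>X\<in>D. \<forall>Y\<in>D. (\<lambda>w. X w + Y w) \<in> D"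
    \<comment> \<open>\<open>- r Y = - k Y + (k - r) Y\<close>: natural stakes against, nonnegative stakes in favour.\<close>
    define k where "k j = nat \<lceil>r j\<rceil>" for j
    have k: "real (k j) - r j \<ge> 0" for j
      by (simp add: k_def real_nat_ceiling_ge)
    have "(\<lambda>w. \<Sum>j=1..m. real (k j) * (Y j w - P (Y j))) \<in> unit_gains D P"
      using closed Y by (intro unit_gains_natural_combination[OF assms(3)]) auto
    then obtain Z q where Z: "Z \<in> D" "q \<ge> 0"
      and merged: "\<And>w. (\<Sum>j=1..m. real (k j) * (Y j w - P (Y j))) = q * (Z w - P Z)"
    proof (unfold unit_gains_def, elim insertE imageE)
      assume "(\<lambda>w. \<Sum>j=1..m. real (k j) * (Y j w - P (Y j))) = (\<lambda>w. 0)"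
      from fun_cong[OF this] show thesis
        using that[of Z0 0] Z0 by simp
    next
      fix Z assume Z: "Z \<in> D"
        and eq: "(\<lambda>w. \<Sum>j=1..m. real (k j) * (Y j w - P (Y j))) = (\<lambda>w. Z w - P Z)"
      from fun_cong[OF eq] show thesis
        using that[of Z 1] Z by simp
    qed
    have eq: "(\<Sum>j=1..m. r j * (Y j w - P (Y j))) =
        q * (Z w - P Z) - (\<Sum>j=1..m. (real (k j) - r j) * (Y j w - P (Y j)))" for w
      unfolding merged[symmetric] sum_subtractf[symmetric]
      by (rule sum.cong) (simp_all add: algebra_simps)
    have "(SUP w. (\<Sum>i=1..n. s i * (X i w - P (X i)))
            + (\<Sum>j=1..m. (real (k j) - r j) * (Y j w - P (Y j))) - q * (Z w - P Z)) \<ge> 0"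
      using X Y Z k by (intro bi_coherent_two_families[OF assms(3)]) auto
    then show ?thesis
      by (simp only: eq) (simp add: algebra_simps)
  qed
  then show ?thesis
    unfolding dF_coherent_def by blast
qed

end
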